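(* Let $p$ be a prime, let $\mathcal{T}_p$ be the rooted $p$-adic tree, and let $\Gamma\leq \operatorname{Aut}\mathcal{T}_p$ be the standard Sylow pro-$p$ subgroup. Let $G\leq\Gamma$ be a nonabelian fractal group whose abelianization $G/G'$ is torsion-free. Then $L(G)=1$, i.e. the only left Engel element of $G$ is the identity.
   Context: Automorphisms act on the right. For a group $G$, $G'$ is the derived subgroup, $[x,y]=x^{-1}y^{-1}xy$, $[x,_1y]=[x,y]$, $[x,_ny]=[[x,_{n-1}y],y]$ for $n\ge 2$. An element $g\in G$ is left Engel if for every $x\in G$ there is $n=n(g,x)\ge1$ with $[x,_ng]=1$; $L(G)$ denotes the set of left Engel elements of $G$. $\mathcal{T}_d$ is the rooted tree in which every vertex has $d$ children; $\mathrm{st}(n)$ is the subgroup of $\operatorname{Aut}\mathcal{T}_d$ fixing every vertex of the $n$-th level, and $\mathrm{st}_G(n)=\mathrm{st}(n)\cap G$. The map $\psi:\mathrm{st}(1)\to \operatorname{Aut}\mathcal{T}_d\times\overset{d}{\cdots}\times\operatorname{Aut}\mathcal{T}_d$ is the isomorphism sending $g$ to the tuple of its sections at the first-level vertices (its actions on the subtrees hanging from these vertices, each identified with $\mathcal{T}_d$). A rooted automorphism rigidly permutes the $d$ subtrees hanging from the first-level vertices according to a permutation in $S_d$, with which it is identified. Every $g\in\operatorname{Aut}\mathcal{T}_d$ is uniquely $g=g_0\sigma$ with $g_0\in\mathrm{st}(1)$ and $\sigma$ rooted. $G\leq\operatorname{Aut}\mathcal{T}_d$ is self-similar if $\psi(g_0)\in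 G\times\overset{d}{\cdots}\times G$ for all $g=g_0\sigma\in G$. $\Gamma$ is the subgroup of $\operatorname{Aut}\mathcal{T}_p$ corresponding to the iterated wreath product $((\cdots\wr\langle\sigma\rangle)\wr\langle\sigma\rangle)\wr\langle\sigma\rangle$, where $\sigma=(1\,2\,\dots\,p)$; i.e. the automorphisms whose local permutation at every vertex is a power of $(1\,2\,\dots\,p)$. For $G\le\Gamma$, $G$ is fractal if it is self-similar and $\pi_i(\psi(\mathrm{st}_G(1)))=G$ for all $i=1,\dots,p$, where $\pi_i$ is projection onto the $i$-th component (for subgroups of $\Gamma$ this is equivalent to the usual definition using stabilizers of first-level vertices). *)

theory Defs
  imports
    "HOL-Algebra.Generated_Groups"
    "HOL-Combinatorics.Cycles"
    "HOL-Computational_Algebra.Primes"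
begin

section \<open>Left Engel elements and torsion-freeness\<close>

definition comm_elt :: "('a, 'b) monoid_scheme \<Rightarrow> 'a \<Rightarrow> 'a \<Rightarrow> 'a" where
  "comm_elt G x y = inv\<^bsub>G\<^esub> x \<otimes>\<^bsub>G\<^esub> inv\<^bsub>G\<^esub> y \<otimes>\<^bsub>G\<^esub> x \<otimes>\<^bsub>G\<^esub> y"

(* For n >= 1 this is [x, _n y]; the value x at n = 0 only starts the recursion. *)
primrec iter_comm :: "('a, 'b) monoid_scheme \<Rightarrow> 'a \<Rightarrow> nat \<Rightarrow> 'a \<Rightarrow> 'a" where
  "iter_comm G x 0 y = x"
| "iter_comm G x (Suc n) y = comm_elt G (iter_comm G x n y) y"

definition left_engel :: "('a, 'b) monoid_scheme \<Rightarrow> 'a set" where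
  "left_engel G =
    {g \<in> carrier G. \<forall>x \<in> carrier G. \<exists>n::nat. 1 \<le> n \<and> iter_comm G x n g = \<one>\<^bsub>G\<^esub>}"

definition torsion_free :: "('a, 'b) monoid_scheme \<Rightarrow> bool" where
  "torsion_free G \<longleftrightarrow>
    (\<forall>x \<in> carrier G. \<forall>n::nat. 0 < n \<longrightarrow> x [^]\<^bsub>G\<^esub> n = \<one>\<^bsub>G\<^esub> \<longrightarrow> x = \<one>\<^bsub>G\<^esub>)"

definition abelianization :: "('a, 'b) monoid_scheme \<Rightarrow> 'a set monoid" where
  "abelianization G = G Mod (derived G (carrier G))"


section \<open>Automorphisms of the \<open>d\<close>-adic rooted tree\<close>

text \<open>Vertices are the finite words over \<open>{1..d}\<close>; the root is the empty word, and the children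
  of \<open>v\<close> are the words \<open>v @ [i]\<close>.\<close>

definition vertices :: "nat \<Rightarrow> nat list set" where
  "vertices d = lists {1..d}"

definition adjacent :: "nat list \<Rightarrow> nat list \<Rightarrow> bool" where
  "adjacent u v \<longleftrightarrow> (\<exists>i. v = u @ [i] \<or> u = v @ [i])"

(* Off the set of vertices an automorphism is the identity (part of "permutes"), so that equality
   of automorphisms is equality of functions. Automorphisms act on the right: the product of
   g and h applies g first. *)
definition tree_aut :: "nat \<Rightarrow> (nat list \<Rightarrow> nat list) monoid" where
  "tree_aut d =
    \<lparr>carrier = {g. g permutes vertices d \<and> g [] = [] \<and>
       (\<forall>u \<in> vertices d. \<forall>v \<in> vertices d. adjacent (g u) (g v) \<longleftrightarrow> adjacent u v)},
     monoid.mult = (\<lambda>g h. h \<circ> g),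
     one = id\<rparr>"

lemma group_tree_aut: "group (tree_aut d)"
proof (rule groupI)
  fix g assume g: "g \<in> carrier (tree_aut d)"
  then have p: "g permutes vertices d" by (simp add: tree_aut_def)
  define h where "h = inv_into UNIV g"
  have h: "h permutes vertices d" "h \<circ> g = id" "g \<circ> h = id"
    using p unfolding h_def by (simp_all add: permutes_inv permutes_inv_o)
  then have gh: "g (h v) = v" and hg: "h (g v) = v" for v
    by (metis comp_apply id_apply)+
  have "adjacent (h u) (h v) \<longleftrightarrow> adjacent u v" if "u \<in> vertices d" "v \<in> vertices d" for u v
  proof -
    have "h u \<in> vertices d" "h v \<in> vertices d"
      using that h by (simp_all add: permutes_in_image)
    then have "adjacent (g (h u)) (g (h v)) \<longleftrightarrow> adjacent (h u) (h v)"
      using g by (simp add: tree_aut_def)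
    then show ?thesis by (simp add: gh)
  qed
  moreover have "h [] = []"
    using g hg[of "[]"] by (simp add: tree_aut_def)
  ultimately have "h \<in> carrier (tree_aut d)"
    using h by (simp add: tree_aut_def)
  moreover have "h \<otimes>\<^bsub>tree_aut d\<^esub> g = \<one>\<^bsub>tree_aut d\<^esub>"
    using h by (simp add: tree_aut_def)
  ultimately show "\<exists>h \<in> carrier (tree_aut d). h \<otimes>\<^bsub>tree_aut d\<^esub> g = \<one>\<^bsub>tree_aut d\<^esub>"
    by blast
qed (auto simp: tree_aut_def permutes_compose permutes_id permutes_in_image o_assoc)

definition level_stab :: "nat \<Rightarrow> (nat list \<Rightarrow> nat list) set \<Rightarrow> nat \<Rightarrow> (nat list \<Rightarrow> nat list) set" where
  "level_stab d G n = {g \<in> G. \<forall>v \<in> vertices d. length v = n \<longrightarrow> g v = v}"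

text \<open>The section at \<open>v\<close> is characterised by \<open>g (v @ w) = g v @ section_at g v w\<close>.\<close>

definition section_at :: "(nat list \<Rightarrow> nat list) \<Rightarrow> nat list \<Rightarrow> nat list \<Rightarrow> nat list" where
  "section_at g v w = drop (length v) (g (v @ w))"

definition psi :: "nat \<Rightarrow> (nat list \<Rightarrow> nat list) \<Rightarrow> nat \<Rightarrow> (nat list \<Rightarrow> nat list)" where
  "psi d g = (\<lambda>i \<in> {1..d}. section_at g [i])"

definition rooted :: "nat \<Rightarrow> (nat \<Rightarrow> nat) \<Rightarrow> nat list \<Rightarrow> nat list" where
  "rooted d \<pi> v = (if v \<in> vertices d \<and> v \<noteq> [] then \<pi> (hd v) # tl v else v)"

text \<open>The pair \<open>(g\<^sub>0, \<pi>)\<close> below exists and is unique for every \<open>g\<close>.\<close>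

definition self_similar :: "nat \<Rightarrow> (nat list \<Rightarrow> nat list) set \<Rightarrow> bool" where
  "self_similar d G \<longleftrightarrow>
    (\<forall>g \<in> G. \<forall>g\<^sub>0 \<in> level_stab d (carrier (tree_aut d)) 1. \<forall>\<pi>.
       \<pi> permutes {1..d} \<and> g = g\<^sub>0 \<otimes>\<^bsub>tree_aut d\<^esub> rooted d \<pi> \<longrightarrow>
       psi d g\<^sub>0 \<in> {1..d} \<rightarrow>\<^sub>E G)"

definition fractal :: "nat \<Rightarrow> (nat list \<Rightarrow> nat list) set \<Rightarrow> bool" where
  "fractal d G \<longleftrightarrow>
    self_similar d G \<and> (\<forall>i \<in> {1..d}. (\<lambda>g. psi d g i) ` level_stab d G 1 = G)"

text \<open>The permutation that \<open>g\<close> induces from the children of \<open>v\<close> to the children of \<open>g v\<close>.\<close>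

definition local_perm :: "(nat list \<Rightarrow> nat list) \<Rightarrow> nat list \<Rightarrow> nat \<Rightarrow> nat" where
  "local_perm g v i = last (g (v @ [i]))"

definition Gamma_sylow :: "nat \<Rightarrow> (nat list \<Rightarrow> nat list) set" where
  "Gamma_sylow p =
    {g \<in> carrier (tree_aut p). \<forall>v \<in> vertices p. \<exists>k::nat. \<forall>i \<in> {1..p}.
       local_perm g v i = (cycle_of_list [1..<Suc p] ^^ k) i}"

end

theory Submission
  imports Defs "HOL-Algebra.FiniteProduct" "HOL-Number_Theory.Cong"
begin

text \<open>Sections of left Engel elements in \<open>st\<^sub>G(1)\<close> are left Engel by fractality, so if \<open>L(G) \<noteq> 1\<close> there
  is \<open>g \<in> L(G)\<close> permuting the first level as a \<open>p\<close>-cycle. Modulo \<open>G'\<close>, commutation with \<open>g\<close> acts on the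
  tuple of sections of \<open>h \<in> st\<^sub>G(1)\<close> as a cyclic shift minus the identity; as \<open>G/G'\<close> is torsion-free, the
  Engel condition forces the sections of \<open>h\<close> to agree modulo \<open>G'\<close>. For \<open>h \<in> G'\<close> the product of the
  sections lies in \<open>G'\<close>, so the \<open>p\<close>-th power of each section does, hence so does each section. Thus
  \<open>G' \<le> st(1)\<close> is closed under sections, and \<open>G' = 1\<close>.\<close>

section \<open>Engel elements and torsion-free commutative groups\<close>

lemma (in group) comm_elt_closed [simp]:
  "\<lbrakk>x \<in> carrier G; y \<in> carrier G\<rbrakk> \<Longrightarrow> comm_elt G x y \<in> carrier G"
  by (simp add: comm_elt_def)

text \<open>The right-hand equation is free of inverses, so root actions and sections of commutators
  can be computed from the product rules alone.\<close>

lemma (in group) comm_elt_unique: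
  assumes "x \<in> carrier G" "y \<in> carrier G" "z \<in> carrier G"
  shows "z = comm_elt G x y \<longleftrightarrow> y \<otimes> x \<otimes> z = x \<otimes> y"
proof -
  have "comm_elt G x y = inv (y \<otimes> x) \<otimes> (x \<otimes> y)"
    using assms by (simp add: comm_elt_def inv_mult_group m_assoc)
  then show ?thesis
    using assms by (metis inv_solve_left m_closed)
qed

lemma (in group) one_in_left_engel: "\<one> \<in> left_engel G"
  by (auto simp: left_engel_def comm_elt_def intro!: exI[of _ 1])

lemma (in group) comm_group_if_derived_trivial:
  assumes "derived G (carrier G) \<subseteq> {\<one>}"
  shows "comm_group G"
proof (rule group_comm_groupI)
  fix x y assume xy: "x \<in> carrier G" "y \<in> carrier G"
  then have "x \<otimes> y \<otimes> inv x \<otimes> inv y \<in> derived G (carrier G)"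
    unfolding derived_def by (blast intro: generate.incl)
  then have "x \<otimes> y \<otimes> inv x \<otimes> inv y = \<one>"
    using assms by blast
  then show "x \<otimes> y = y \<otimes> x"
    using xy by (metis inv_closed inv_equality inv_inv m_closed inv_mult_group m_assoc)
qed

text \<open>With \<open>T\<close> the shift by \<open>\<tau>\<close>, the recursion says \<open>T c\<^sub>n\<^sub>+\<^sub>1 = (1 - T) c\<^sub>n\<close> additively. If
  \<open>(1 - T)\<^sup>2 c = 0\<close> and \<open>d = (1 - T) c\<close>, then \<open>c = T\<^sup>m c + m d = c + m d\<close>, so \<open>m d = 0\<close>.\<close>

lemma (in comm_group) torsion_free_shift_differences:
  fixes \<tau> :: "'i \<Rightarrow> 'i" and c :: "nat \<Rightarrow> 'i \<Rightarrow> 'a"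
  assumes tf: "torsion_free G"
    and \<tau>: "\<And>i. i \<in> I \<Longrightarrow> \<tau> i \<in> I" "\<And>i. i \<in> I \<Longrightarrow> (\<tau> ^^ m) i = i" "0 < m"
    and c: "\<And>n i. i \<in> I \<Longrightarrow> c n i \<in> carrier G"
    and rec: "\<And>n i. i \<in> I \<Longrightarrow> c (Suc n) (\<tau> i) \<otimes> c n (\<tau> i) = c n i"
    and fin: "\<And>i. i \<in> I \<Longrightarrow> c (Suc N) i = \<one>"
    and i: "i \<in> I"
  shows "c (Suc 0) i = \<one>"
proof -
  \<comment> \<open>One step of a descent in n: by \<open>inv\<close>, \<open>c (Suc n)\<close> is
    constant along \<tau>, so following \<tau> for m steps, back to i, collects its m-th
    power.\<close>
  have step: "c (Suc n) i = \<one>" if z: "\<And>i. i \<in> I \<Longrightarrow> c (Suc (Suc n)) i = \<one>" and i: "i \<in> I" for n i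
  proof -
    have inv: "c (Suc n) (\<tau> j) = c (Suc n) j" if "j \<in> I" for j
      using rec[OF that, of "Suc n"] z \<tau>(1) c that by simp
    have "(\<tau> ^^ k) i \<in> I \<and> c (Suc n) ((\<tau> ^^ k) i) = c (Suc n) i
        \<and> c n i = c (Suc n) i [^] k \<otimes> c n ((\<tau> ^^ k) i)" for k
    proof (induction k)
      case 0
      then show ?case using i c by simp
    next
      case (Suc k)
      let ?j = "(\<tau> ^^ k) i"
      have j: "?j \<in> I" "\<tau> ?j \<in> I" using Suc \<tau>(1) by auto
      have "c n ?j = c (Suc n) i \<otimes> c n (\<tau> ?j)"
        using rec[OF j(1), of n] inv[OF j(1)] Suc by simp
      then have "c n i = c (Suc n) i [^] k \<otimes> (c (Suc n) i \<otimes> c n (\<tau> ?j))"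
        using Suc by simp
      then show ?case
        using j inv[OF j(1)] Suc c i by (simp add: m_assoc)
    qed
    from this[of m] have "c n i = c (Suc n) i [^] m \<otimes> c n i"
      using \<tau>(2)[OF i] by simp
    then have "c (Suc n) i [^] m = \<one>"
      using c i by (metis r_cancel_one' nat_pow_closed)
    then show ?thesis
      using tf c i \<tau>(3) unfolding torsion_free_def by blast
  qed
  \<comment> \<open>The descent ends at index 1, since each step uses the recursion one index
    lower.\<close>
  have "(\<forall>i\<in>I. c (Suc N) i = \<one>) \<longrightarrow> (\<forall>i\<in>I. c (Suc 0) i = \<one>)"
    by (induction N) (use step in auto)
  then show ?thesis using fin i by blast
qed


section \<open>Sections of tree automorphisms\<close>

text \<open>The number i stands at position i - 1 of the list, and the k-th power of the cycle
  rotates the list by k places; hence addition modulo n on positions.\<close>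

lemma cycle_upt_funpow:
  assumes "i \<in> {1..n}"
  shows "(cycle_of_list [1..<Suc n] ^^ k) i = (i - 1 + k) mod n + 1"
proof -
  let ?cs = "[1..<Suc n]"
  have i: "i - 1 < length ?cs" "?cs ! (i - 1) = i"
    using assms by (auto simp del: upt_Suc)
  have "(cycle_of_list ?cs ^^ k) i = map (cycle_of_list ?cs ^^ k) ?cs ! (i - 1)"
    using i by (simp del: upt_Suc)
  also have "\<dots> = rotate k ?cs ! (i - 1)"
    by (subst cyclic_rotation) simp_all
  also have "\<dots> = ?cs ! ((i - 1 + k) mod n)"
    using i by (simp add: nth_rotate add.commute del: upt_Suc)
  also have "\<dots> = (i - 1 + k) mod n + 1"
    using assms by (subst nth_upt) auto
  finally show ?thesis .
qed

lemma tree_autD: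
  assumes "g \<in> carrier (tree_aut d)"
  shows "g permutes vertices d" "g [] = []"
    "\<lbrakk>u \<in> vertices d; v \<in> vertices d\<rbrakk> \<Longrightarrow> adjacent (g u) (g v) \<longleftrightarrow> adjacent u v"
  using assms by (auto simp: tree_aut_def)

text \<open>The image of a child of v is adjacent to \<open>g v\<close>, hence a child or the parent
  of \<open>g v\<close>. By induction from the root that parent is already the image of the parent
  of v, so injectivity excludes it.\<close>

lemma tree_aut_snoc:
  assumes g: "g \<in> carrier (tree_aut d)"
  shows "v @ [i] \<in> vertices d \<Longrightarrow> \<exists>j. g (v @ [i]) = g v @ [j]"
proof (induction v arbitrary: i rule: rev_induct)
  case Nil
  have "adjacent (g []) (g [i])"
    using Nil tree_autD(3)[OF g, of "[]" "[i]"] by (simp add: vertices_def adjacent_def)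
  then show ?case using tree_autD(2)[OF g] by (auto simp: adjacent_def)
next
  case (snoc k v)
  let ?w = "v @ [k]"
  have V: "v \<in> vertices d" "?w \<in> vertices d" "?w @ [i] \<in> vertices d"
    using snoc.prems by (auto simp: vertices_def)
  obtain j where j: "g ?w = g v @ [j]" using snoc.IH V by blast
  have "adjacent (g ?w) (g (?w @ [i]))"
    using V by (simp only: tree_autD(3)[OF g]) (auto simp: adjacent_def)
  moreover have "g (?w @ [i]) \<noteq> g v"
  proof
    assume "g (?w @ [i]) = g v"
    then have "?w @ [i] = v"
      using permutes_inj[OF tree_autD(1)[OF g]] by (auto dest: injD)
    then show False by simp
  qed
  ultimately show ?case using j by (auto simp: adjacent_def)
qed

lemma tree_aut_append:
  assumes g: "g \<in> carrier (tree_aut d)"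
  shows "v @ w \<in> vertices d \<Longrightarrow> \<exists>u. length u = length w \<and> g (v @ w) = g v @ u"
proof (induction w rule: rev_induct)
  case (snoc i w)
  then obtain u where "length u = length w" "g (v @ w) = g v @ u"
    by (auto simp: vertices_def)
  moreover obtain j where "g ((v @ w) @ [i]) = g (v @ w) @ [j]"
    using tree_aut_snoc[OF g, of "v @ w" i] snoc.prems by auto
  ultimately show ?case by (intro exI[of _ "u @ [j]"]) simp
qed simp

lemma tree_aut_singleton:
  assumes "g \<in> carrier (tree_aut d)" "i \<in> {1..d}"
  shows "g [i] = [local_perm g [] i]"
  using tree_aut_snoc[OF assms(1), of "[]" i] tree_autD(2)[OF assms(1)] assms(2)
  by (auto simp: vertices_def local_perm_def)

lemma local_perm_root_range:
  assumes "g \<in> carrier (tree_aut d)" "i \<in> {1..d}"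
  shows "local_perm g [] i \<in> {1..d}"
proof -
  have "g [i] \<in> vertices d"
    using permutes_in_image[OF tree_autD(1)[OF assms(1)], of "[i]"] assms(2)
    by (simp add: vertices_def)
  then show ?thesis using tree_aut_singleton[OF assms] by (simp add: vertices_def)
qed

lemma tree_aut_Cons:
  assumes "g \<in> carrier (tree_aut d)" "i \<in> {1..d}" "w \<in> vertices d"
  shows "g (i # w) = local_perm g [] i # section_at g [i] w"
  using tree_aut_append[OF assms(1), of "[i]" w] tree_aut_singleton[OF assms(1,2)] assms(2,3)
  by (auto simp: vertices_def section_at_def)

text \<open>Automorphisms are compared as functions on all lists, so values at non-vertices must be
  settled too.\<close>

lemma section_outside:
  assumes "g \<in> carrier (tree_aut d)" "w \<notin> vertices d"
  shows "section_at g [i] w = w"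
proof -
  have "i # w \<notin> vertices d" using assms(2) by (simp add: vertices_def)
  then show ?thesis
    using permutes_not_in[OF tree_autD(1)[OF assms(1)]] by (simp add: section_at_def)
qed

lemma local_perm_root_mult:
  assumes "x \<in> carrier (tree_aut d)" "y \<in> carrier (tree_aut d)" "i \<in> {1..d}"
  shows "local_perm (x \<otimes>\<^bsub>tree_aut d\<^esub> y) [] i = local_perm y [] (local_perm x [] i)"
  using tree_aut_singleton[OF assms(1,3)]
  by (simp add: tree_aut_def local_perm_def)

text \<open>x carries the subtree below i to the one below \<open>local_perm x [] i\<close>, and y
  acts on it there.\<close>

lemma section_mult:
  assumes "x \<in> carrier (tree_aut d)" "y \<in> carrier (tree_aut d)" "i \<in> {1..d}"
  shows "section_at (x \<otimes>\<^bsub>tree_aut d\<^esub> y) [i] =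
    section_at x [i] \<otimes>\<^bsub>tree_aut d\<^esub> section_at y [local_perm x [] i]"
proof
  fix w
  have m: "x \<otimes>\<^bsub>tree_aut d\<^esub> y = y \<circ> x" for x y by (simp add: tree_aut_def)
  have xy: "y \<circ> x \<in> carrier (tree_aut d)"
    using group.is_monoid[OF group_tree_aut] assms(1,2) by (metis m monoid.m_closed)
  show "section_at (x \<otimes>\<^bsub>tree_aut d\<^esub> y) [i] w =
    (section_at x [i] \<otimes>\<^bsub>tree_aut d\<^esub> section_at y [local_perm x [] i]) w"
  proof (cases "w \<in> vertices d")
    case True
    then show ?thesis
      using tree_aut_Cons[OF assms(1,3)] by (simp add: m section_at_def)
  next
    case False
    then show ?thesis using section_outside xy assms by (simp add: m)
  qed
qed

lemma level_stab_1_iff: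
  assumes "G \<subseteq> carrier (tree_aut d)"
  shows "g \<in> level_stab d G 1 \<longleftrightarrow> g \<in> G \<and> (\<forall>i\<in>{1..d}. local_perm g [] i = i)"
proof -
  have "(\<forall>v\<in>vertices d. length v = 1 \<longrightarrow> g v = v) \<longleftrightarrow> (\<forall>i\<in>{1..d}. g [i] = [i])"
    by (auto simp: vertices_def length_Suc_conv)
  moreover have "g [i] = [i] \<longleftrightarrow> local_perm g [] i = i" if "g \<in> G" "i \<in> {1..d}" for i
    using tree_aut_singleton[of g d i] assms that by auto
  ultimately show ?thesis
    by (auto simp: level_stab_def)
qed

lemma rooted_rooted:
  assumes "\<rho>' permutes {1..d}" "\<And>i. \<rho> (\<rho>' i) = i"
  shows "rooted d \<rho> (rooted d \<rho>' v) = v"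
  using assms permutes_in_image[OF assms(1)]
  by (cases v) (auto simp: rooted_def vertices_def)

lemma rooted_in_tree_aut:
  assumes \<pi>: "\<pi> permutes {1..d}"
  shows "rooted d \<pi> \<in> carrier (tree_aut d)"
proof -
  let ?\<pi>' = "inv_into UNIV \<pi>"
  have inv: "rooted d \<pi> (rooted d ?\<pi>' v) = v" "rooted d ?\<pi>' (rooted d \<pi> v) = v" for v
    using \<pi> by (simp_all add: rooted_rooted permutes_inv permutes_inverses)
  have "rooted d \<pi> permutes vertices d"
    unfolding permutes_def by (metis inv rooted_def)
  moreover have "rooted d \<pi> [] = []" by (simp add: rooted_def)
  moreover have "adjacent (rooted d \<pi> u) (rooted d \<pi> v) \<longleftrightarrow> adjacent u v"
    if "u \<in> vertices d" "v \<in> vertices d" for u v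
    using that permutes_inj[OF \<pi>]
    by (cases u; cases v) (auto simp: rooted_def adjacent_def Cons_eq_append_conv inj_eq)
  ultimately show ?thesis by (simp add: tree_aut_def)
qed

text \<open>Multiplying g by the inverse rooted automorphism undoes its action on the first level.
  Rooted automorphisms have trivial sections, so the sections of g survive. This links sections of
  arbitrary elements to the wording of \<open>self_similar\<close>.\<close>

lemma rooted_decomposition:
  assumes g: "g \<in> carrier (tree_aut d)" and \<pi>: "\<pi> permutes {1..d}"
    and act: "\<And>i. i \<in> {1..d} \<Longrightarrow> local_perm g [] i = \<pi> i"
  obtains g\<^sub>0 where "g\<^sub>0 \<in> level_stab d (carrier (tree_aut d)) 1"
    "g = g\<^sub>0 \<otimes>\<^bsub>tree_aut d\<^esub> rooted d \<pi>"
    "\<And>i. i \<in> {1..d} \<Longrightarrow> section_at g\<^sub>0 [i] = section_at g [i]"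
proof
  let ?r = "rooted d (inv_into UNIV \<pi>)"
  let ?g\<^sub>0 = "g \<otimes>\<^bsub>tree_aut d\<^esub> ?r"
  have \<pi>': "inv_into UNIV \<pi> permutes {1..d}" using \<pi> by (rule permutes_inv)
  have r: "?r \<in> carrier (tree_aut d)" using \<pi>' by (rule rooted_in_tree_aut)
  have range: "\<pi> i \<in> {1..d}" if "i \<in> {1..d}" for i
    using permutes_in_image[OF \<pi>] that by blast
  have "?g\<^sub>0 \<in> carrier (tree_aut d)"
    by (intro monoid.m_closed group.is_monoid group_tree_aut g r)
  moreover have "local_perm ?r [] (\<pi> i) = i" if "i \<in> {1..d}" for i
    using range[OF that] permutes_inverses(2)[OF \<pi>]
    by (simp add: local_perm_def rooted_def vertices_def)
  ultimately show "?g\<^sub>0 \<in> level_stab d (carrier (tree_aut d)) 1"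
    using local_perm_root_mult[OF g r] act by (simp add: level_stab_1_iff[OF subset_refl, simplified])
  show "g = ?g\<^sub>0 \<otimes>\<^bsub>tree_aut d\<^esub> rooted d \<pi>"
    using rooted_rooted[OF \<pi>' permutes_inverses(1)[OF \<pi>]]
    by (simp add: tree_aut_def fun_eq_iff)
  have "section_at ?r [j] = id" for j
    by (auto simp: section_at_def rooted_def)
  then show "section_at ?g\<^sub>0 [i] = section_at g [i]" if "i \<in> {1..d}" for i
    using section_mult[OF g r that] by (simp add: tree_aut_def)
qed

text \<open>Induction along a word: its first letter is fixed, and its tail is moved by a section
  that lies in S again. Later S is the set of left Engel elements or the derived subgroup.\<close>

lemma sections_trivial_imp_trivial:
  assumes sub: "S \<subseteq> carrier (tree_aut d)"
    and triv: "\<And>g i. \<lbrakk>g \<in> S; i \<in> {1..d}\<rbrakk> \<Longrightarrow> local_perm g [] i = i"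
    and sec: "\<And>g i. \<lbrakk>g \<in> S; i \<in> {1..d}\<rbrakk> \<Longrightarrow> section_at g [i] \<in> S"
    and g: "g \<in> S"
  shows "g = \<one>\<^bsub>tree_aut d\<^esub>"
proof -
  have "g w = w" if "w \<in> vertices d" "g \<in> S" for w g
    using that
  proof (induction w arbitrary: g)
    case Nil
    then show ?case using sub tree_autD(2) by blast
  next
    case (Cons i w)
    then have i: "i \<in> {1..d}" "w \<in> vertices d" by (auto simp: vertices_def)
    have "g (i # w) = local_perm g [] i # section_at g [i] w"
      using tree_aut_Cons[OF _ i] Cons.prems sub by blast
    then show ?case using triv sec i Cons by metis
  qed
  moreover have "g w = w" if "w \<notin> vertices d" for w
    using permutes_not_in[OF tree_autD(1) that] sub g by blast
  ultimately have "g w = w" for w using g by blast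
  then show ?thesis by (simp add: tree_aut_def fun_eq_iff)
qed


section \<open>Self-similar and fractal groups of tree automorphisms\<close>

locale fractal_subgroup =
  fixes p :: nat and G :: "(nat list \<Rightarrow> nat list) set"
  assumes prime_p: "Factorial_Ring.prime p"
    and subgroup_G: "subgroup G (tree_aut p)"
    and Gamma: "G \<subseteq> Gamma_sylow p"
    and fractal: "fractal p G"
begin

section \<open>Root action and sections of elements of G\<close>

abbreviation grp where "grp \<equiv> (tree_aut p)\<lparr>carrier := G\<rparr>"

abbreviation act where "act g \<equiv> local_perm g []"

abbreviation sec where "sec g i \<equiv> section_at g [i]"

abbreviation cyc where "cyc \<equiv> cycle_of_list [1..<Suc p]"

sublocale group grp
  by (rule group.subgroup_imp_group[OF group_tree_aut subgroup_G])

lemma in_tree_aut: "g \<in> G \<Longrightarrow> g \<in> carrier (tree_aut p)"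
  using subgroup.subset[OF subgroup_G] by blast

lemma act_range [simp]: "\<lbrakk>g \<in> G; i \<in> {1..p}\<rbrakk> \<Longrightarrow> act g i \<in> {1..p}"
  using local_perm_root_range in_tree_aut by blast

lemma act_cycle_power:
  assumes "g \<in> G"
  obtains k where "\<And>i. i \<in> {1..p} \<Longrightarrow> act g i = (cyc ^^ k) i"
proof -
  have "[] \<in> vertices p" by (simp add: vertices_def)
  then show ?thesis using assms Gamma that unfolding Gamma_sylow_def by blast
qed

lemma act_mult:
  "\<lbrakk>x \<in> G; y \<in> G; i \<in> {1..p}\<rbrakk> \<Longrightarrow> act (x \<otimes>\<^bsub>grp\<^esub> y) i = act y (act x i)"
  using local_perm_root_mult in_tree_aut by simp

lemma sec_mult:
  "\<lbrakk>x \<in> G; y \<in> G; i \<in> {1..p}\<rbrakk> \<Longrightarrow> sec (x \<otimes>\<^bsub>grp\<^esub> y) i = sec x i \<otimes>\<^bsub>grp\<^esub> sec y (act x i)"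
  using section_mult in_tree_aut by simp

lemma act_one [simp]: "i \<in> {1..p} \<Longrightarrow> act \<one>\<^bsub>grp\<^esub> i = i"
  by (simp add: local_perm_def tree_aut_def)

lemma sec_one: "sec \<one>\<^bsub>grp\<^esub> i = \<one>\<^bsub>grp\<^esub>"
  by (simp add: tree_aut_def section_at_def fun_eq_iff)

text \<open>Both root actions are powers of the same cycle. Consequently commutators act trivially
  on the first level.\<close>

lemma act_commute:
  assumes "x \<in> G" "y \<in> G" "i \<in> {1..p}"
  shows "act x (act y i) = act y (act x i)"
proof -
  obtain k l where "\<And>i. i \<in> {1..p} \<Longrightarrow> act x i = (cyc ^^ k) i"
      "\<And>i. i \<in> {1..p} \<Longrightarrow> act y i = (cyc ^^ l) i"
    using act_cycle_power assms by metis
  moreover have "(cyc ^^ k) ((cyc ^^ l) i) = (cyc ^^ l) ((cyc ^^ k) i)"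
    by (metis add.commute comp_apply funpow_add)
  ultimately show ?thesis using assms act_range by metis
qed

lemma act_bij: "g \<in> G \<Longrightarrow> bij_betw (act g) {1..p} {1..p}"
proof (rule bij_betw_byWitness[where f' = "act (inv\<^bsub>grp\<^esub> g)"])
  assume g: "g \<in> G"
  then have g': "inv\<^bsub>grp\<^esub> g \<in> G" using inv_closed by simp
  show "\<forall>i\<in>{1..p}. act (inv\<^bsub>grp\<^esub> g) (act g i) = i"
    using g g' act_mult[OF g g'] r_inv[of g] act_one by fastforce
  show "\<forall>i\<in>{1..p}. act g (act (inv\<^bsub>grp\<^esub> g) i) = i"
    using g g' act_mult[OF g' g] l_inv[of g] act_one by fastforce
  show "act g ` {1..p} \<subseteq> {1..p}" "act (inv\<^bsub>grp\<^esub> g) ` {1..p} \<subseteq> {1..p}"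
    using g g' act_range by blast+
qed

lemma mem_level_stab: "g \<in> level_stab p G 1 \<longleftrightarrow> g \<in> G \<and> (\<forall>i\<in>{1..p}. act g i = i)"
  using level_stab_1_iff in_tree_aut by blast

lemma sec_closed [simp]:
  assumes g: "g \<in> G" and i: "i \<in> {1..p}"
  shows "sec g i \<in> G"
proof -
  obtain k where k: "\<And>i. i \<in> {1..p} \<Longrightarrow> act g i = (cyc ^^ k) i"
    using act_cycle_power g by blast
  \<comment> \<open>\<open>self_similar\<close> speaks of decompositions with a rooted factor, so a
    permutation must be exhibited: the power of the cycle that g induces at the root.\<close>
  have "cyc permutes {1..p}"
    using cycle_permutes[of "[1..<Suc p]"]
    by (simp add: atLeastLessThanSuc_atLeastAtMost del: upt_Suc)
  then have \<pi>: "cyc ^^ k permutes {1..p}" by (rule permutes_funpow)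
  obtain h where h: "h \<in> level_stab p (carrier (tree_aut p)) 1"
      "g = h \<otimes>\<^bsub>tree_aut p\<^esub> rooted p (cyc ^^ k)" "sec h i = sec g i"
    using rooted_decomposition[OF in_tree_aut[OF g] \<pi>] k i by blast
  then have "psi p h \<in> {1..p} \<rightarrow>\<^sub>E G"
    using fractal g \<pi> unfolding fractal_def self_similar_def by blast
  then show ?thesis using i h(3) by (metis PiE_mem psi_def restrict_apply)
qed

lemma fractalE:
  assumes "x \<in> G" "i \<in> {1..p}"
  obtains h where "h \<in> level_stab p G 1" "sec h i = x"
proof -
  have "x \<in> (\<lambda>g. psi p g i) ` level_stab p G 1"
    using fractal assms by (auto simp: fractal_def)
  then show ?thesis using that assms by (auto simp: psi_def)
qed

section \<open>Commutators and the first level stabilizer\<close>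

lemma act_commutator:
  assumes xyz: "x \<in> G" "y \<in> G" "z \<in> G"
    and eq: "x \<otimes>\<^bsub>grp\<^esub> y \<otimes>\<^bsub>grp\<^esub> z = y \<otimes>\<^bsub>grp\<^esub> x"
    and i: "i \<in> {1..p}"
  shows "act z i = i"
proof -
  have xy: "x \<otimes>\<^bsub>grp\<^esub> y \<in> G" using m_closed xyz by simp
  \<comment> \<open>Every point is an image under the product of x and y; at such a point
    \<open>eq\<close> shows what z does, since the two orders of x and y act alike.\<close>
  have "i \<in> act (x \<otimes>\<^bsub>grp\<^esub> y) ` {1..p}"
    by (simp only: bij_betw_imp_surj_on[OF act_bij[OF xy]] i)
  then obtain j where j: "i = act (x \<otimes>\<^bsub>grp\<^esub> y) j" "j \<in> {1..p}"
    by (rule imageE)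
  have "act z (act (x \<otimes>\<^bsub>grp\<^esub> y) j) = act (x \<otimes>\<^bsub>grp\<^esub> y \<otimes>\<^bsub>grp\<^esub> z) j"
    by (rule act_mult[OF xy xyz(3) j(2), symmetric])
  also have "\<dots> = act x (act y j)"
    by (simp only: eq act_mult[OF xyz(2,1) j(2)])
  also have "\<dots> = act (x \<otimes>\<^bsub>grp\<^esub> y) j"
    by (simp only: act_mult[OF xyz(1,2) j(2)] act_commute[OF xyz(1,2) j(2)])
  finally show ?thesis by (simp only: j(1))
qed

lemma comm_elt_in_stab:
  "\<lbrakk>x \<in> G; y \<in> G\<rbrakk> \<Longrightarrow> comm_elt grp x y \<in> level_stab p G 1"
  using act_commutator[of y x "comm_elt grp x y"] comm_elt_unique[of x y "comm_elt grp x y"]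
    comm_elt_closed by (simp add: mem_level_stab[simplified])

lemma iter_comm_in_stab:
  assumes "h \<in> level_stab p G 1" "g \<in> G"
  shows "iter_comm grp h n g \<in> level_stab p G 1"
proof (induction n)
  case (Suc n)
  then have "iter_comm grp h n g \<in> G" by (simp add: mem_level_stab[simplified])
  then show ?case using comm_elt_in_stab assms(2) by simp
qed (use assms in simp)

text \<open>On the stabilizer, taking the section at i is multiplicative, so the defining equation
  of the commutator passes to sections.\<close>

lemma sec_comm_elt:
  assumes h: "h \<in> level_stab p G 1" and g: "g \<in> level_stab p G 1" and i: "i \<in> {1..p}"
  shows "sec (comm_elt grp h g) i = comm_elt grp (sec h i) (sec g i)"
proof -
  have hg: "h \<in> G" "g \<in> G" "act h i = i" "act g i = i"
    using h g i unfolding mem_level_stab by auto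
  let ?z = "comm_elt grp h g"
  have z: "?z \<in> G" using comm_elt_closed hg by simp
  have gh: "g \<otimes>\<^bsub>grp\<^esub> h \<in> G" "act (g \<otimes>\<^bsub>grp\<^esub> h) i = i"
    using hg m_closed[of g h] act_mult i by simp_all
  have "g \<otimes>\<^bsub>grp\<^esub> h \<otimes>\<^bsub>grp\<^esub> ?z = h \<otimes>\<^bsub>grp\<^esub> g"
    using comm_elt_unique[of h g ?z] hg z by simp
  then have "sec (g \<otimes>\<^bsub>grp\<^esub> h \<otimes>\<^bsub>grp\<^esub> ?z) i = sec (h \<otimes>\<^bsub>grp\<^esub> g) i" by simp
  then have "sec g i \<otimes>\<^bsub>grp\<^esub> sec h i \<otimes>\<^bsub>grp\<^esub> sec ?z i = sec h i \<otimes>\<^bsub>grp\<^esub> sec g i"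
    using sec_mult[OF gh(1) z i] sec_mult[OF hg(1,2) i] sec_mult[OF hg(2,1) i] hg gh by simp
  then show ?thesis
    using comm_elt_unique[of "sec h i" "sec g i" "sec ?z i"] hg z i by simp
qed

lemma sec_iter_comm:
  assumes h: "h \<in> level_stab p G 1" and g: "g \<in> level_stab p G 1" and i: "i \<in> {1..p}"
  shows "sec (iter_comm grp h n g) i = iter_comm grp (sec h i) n (sec g i)"
proof (induction n)
  case (Suc n)
  have "iter_comm grp h n g \<in> level_stab p G 1"
    using h g by (intro iter_comm_in_stab) (simp_all add: mem_level_stab[simplified])
  then show ?case using Suc sec_comm_elt g i by simp
qed simp

text \<open>By fractality every x in G is the section at i of some h in the stabilizer, and the
  Engel identity for h and g restricts to that component.\<close>

lemma left_engel_section: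
  assumes L: "g \<in> left_engel grp" and g: "g \<in> level_stab p G 1" and i: "i \<in> {1..p}"
  shows "sec g i \<in> left_engel grp"
proof -
  have gG: "g \<in> G" using g unfolding mem_level_stab by blast
  have "\<exists>n\<ge>1. iter_comm grp x n (sec g i) = \<one>\<^bsub>grp\<^esub>" if x: "x \<in> G" for x
  proof -
    obtain h where h: "h \<in> level_stab p G 1" "sec h i = x" using fractalE x i by blast
    then have "h \<in> G" unfolding mem_level_stab by blast
    then obtain n where "1 \<le> n" "iter_comm grp h n g = \<one>\<^bsub>grp\<^esub>"
      using L by (auto simp: left_engel_def)
    then show ?thesis
      using sec_iter_comm[OF h(1) g i, of n] h(2) sec_one by auto
  qed
  then show ?thesis using gG i by (simp add: left_engel_def)
qed

section \<open>Classes of sections in the abelianization\<close>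

abbreviation ab where "ab \<equiv> abelianization grp"

definition cls :: "(nat list \<Rightarrow> nat list) \<Rightarrow> (nat list \<Rightarrow> nat list) set" where
  "cls x = derived grp G #>\<^bsub>grp\<^esub> x"

lemma comm_group_ab: "comm_group ab"
  using derived_quot_is_comm_group by (simp add: abelianization_def)

lemma cls_hom: "group_hom grp ab cls"
proof -
  have "(\<lambda>a. derived grp (carrier grp) #>\<^bsub>grp\<^esub> a) \<in> hom grp ab"
    unfolding abelianization_def by (rule normal.r_coset_hom_Mod[OF derived_self_is_normal])
  then show ?thesis
    unfolding group_hom_def group_hom_axioms_def cls_def
    using comm_group_ab comm_group.axioms(2) is_group by auto
qed

lemma cls_closed [simp]: "x \<in> G \<Longrightarrow> cls x \<in> carrier ab"
  using group_hom.hom_closed[OF cls_hom] by simp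

lemma cls_mult: "\<lbrakk>x \<in> G; y \<in> G\<rbrakk> \<Longrightarrow> cls (x \<otimes>\<^bsub>grp\<^esub> y) = cls x \<otimes>\<^bsub>ab\<^esub> cls y"
  using group_hom.hom_mult[OF cls_hom] by simp

lemma cls_eq_one: "\<lbrakk>x \<in> G; cls x = \<one>\<^bsub>ab\<^esub>\<rbrakk> \<Longrightarrow> x \<in> derived grp G"
  using rcos_self[OF _ derived_is_subgroup, of x G]
  by (auto simp: cls_def abelianization_def)

text \<open>The stabilizer is a subgroup and contains the commutators that generate the derived
  subgroup.\<close>

lemma derived_in_stab:
  assumes "x \<in> derived grp G"
  shows "x \<in> level_stab p G 1"
proof -
  have "subgroup (level_stab p G 1) grp"
  proof (rule subgroupI)
    show "level_stab p G 1 \<subseteq> carrier grp"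
      using mem_level_stab by auto
    have "\<one>\<^bsub>grp\<^esub> \<in> level_stab p G 1"
      unfolding mem_level_stab using one_closed act_one by simp
    then show "level_stab p G 1 \<noteq> {}" by blast
    fix a assume a: "a \<in> level_stab p G 1"
    then have aG: "a \<in> G" "inv\<^bsub>grp\<^esub> a \<in> G" "inv\<^bsub>grp\<^esub> a \<otimes>\<^bsub>grp\<^esub> a = \<one>\<^bsub>grp\<^esub>"
      using inv_closed[of a] l_inv[of a] unfolding mem_level_stab by auto
    have "act (inv\<^bsub>grp\<^esub> a) i = i" if i: "i \<in> {1..p}" for i
    proof -
      \<comment> \<open>\<open>act a\<close> fixes every first-level point, so it may be
        inserted.\<close>
      have "act (inv\<^bsub>grp\<^esub> a) i = act a (act (inv\<^bsub>grp\<^esub> a) i)"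
        using a act_range[OF aG(2) i] unfolding mem_level_stab by metis
      also have "\<dots> = i"
        using act_mult[OF aG(2,1) i] aG(3) act_one[OF i] by simp
      finally show ?thesis .
    qed
    then show "inv\<^bsub>grp\<^esub> a \<in> level_stab p G 1"
      using aG unfolding mem_level_stab by blast
    fix b assume b: "b \<in> level_stab p G 1"
    show "a \<otimes>\<^bsub>grp\<^esub> b \<in> level_stab p G 1"
      using a b act_mult m_closed[of a b] unfolding mem_level_stab by simp
  qed
  moreover have "x \<otimes>\<^bsub>grp\<^esub> y \<otimes>\<^bsub>grp\<^esub> inv\<^bsub>grp\<^esub> x \<otimes>\<^bsub>grp\<^esub> inv\<^bsub>grp\<^esub> y \<in> level_stab p G 1"
    if "x \<in> G" "y \<in> G" for x y
  proof -
    \<comment> \<open>The generators in \<open>derived\<close> follow the other commutator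
      convention; each is \<open>comm_elt\<close> of the inverses.\<close>
    have "comm_elt grp (inv\<^bsub>grp\<^esub> x) (inv\<^bsub>grp\<^esub> y) \<in> level_stab p G 1"
      using that inv_closed by (intro comm_elt_in_stab) simp_all
    then show ?thesis
      using that inv_inv by (simp add: comm_elt_def)
  qed
  ultimately have "derived grp G \<subseteq> level_stab p G 1"
    unfolding derived_def by (intro generate_subgroup_incl) blast+
  then show ?thesis using assms by blast
qed

text \<open>The product is essentially the transfer, a homomorphism to an abelian group.\<close>

lemma prod_cls_sec_derived:
  assumes "x \<in> derived grp G"
  shows "(\<Otimes>\<^bsub>ab\<^esub>i\<in>{1..p}. cls (sec x i)) = \<one>\<^bsub>ab\<^esub>"
proof -
  interpret ab: comm_group ab by (rule comm_group_ab)
  let ?T = "\<lambda>x. \<Otimes>\<^bsub>ab\<^esub>i\<in>{1..p}. cls (sec x i)"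
  have "?T (x \<otimes>\<^bsub>grp\<^esub> y) = ?T x \<otimes>\<^bsub>ab\<^esub> ?T y" if xy: "x \<in> G" "y \<in> G" for x y
  proof -
    \<comment> \<open>The section of a product reads y at shifted indices; as \<open>act x\<close>
      permutes {1..p}, reindexing removes the shift.\<close>
    have im: "act x ` {1..p} = {1..p}" and inj: "inj_on (act x) {1..p}"
      using act_bij[OF xy(1)] by (auto simp: bij_betw_def)
    have "cls (sec (x \<otimes>\<^bsub>grp\<^esub> y) i) = cls (sec x i) \<otimes>\<^bsub>ab\<^esub> cls (sec y (act x i))"
      if i: "i \<in> {1..p}" for i
      using cls_mult[OF sec_closed[OF xy(1) i] sec_closed[OF xy(2) act_range[OF xy(1) i]]]
      by (simp only: sec_mult[OF xy i])
    then have "?T (x \<otimes>\<^bsub>grp\<^esub> y) = (\<Otimes>\<^bsub>ab\<^esub>i\<in>{1..p}. cls (sec x i) \<otimes>\<^bsub>ab\<^esub> cls (sec y (act x i)))"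
      using xy act_range by (intro ab.finprod_cong' refl) auto
    also have "\<dots> = ?T x \<otimes>\<^bsub>ab\<^esub> (\<Otimes>\<^bsub>ab\<^esub>i\<in>{1..p}. cls (sec y (act x i)))"
      using xy act_range by (intro ab.finprod_multf) auto
    also have "(\<Otimes>\<^bsub>ab\<^esub>i\<in>{1..p}. cls (sec y (act x i))) = ?T y"
      using ab.finprod_reindex[OF _ inj, of "\<lambda>i. cls (sec y i)"] xy im by auto
    finally show ?thesis .
  qed
  then have "?T \<in> hom grp ab"
    by (auto simp: hom_def intro!: ab.finprod_closed)
  then have T: "group_hom grp ab ?T"
    by (simp add: group_hom_def group_hom_axioms_def is_group ab.is_group)
  \<comment> \<open>A homomorphism maps the derived subgroup onto that of its image, which is
    trivial in the abelian group \<open>ab\<close>.\<close>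
  then have "?T ` derived grp G = derived ab (?T ` G)"
    using group_hom.derived_img[OF T, of G] by simp
  also have "\<dots> = {\<one>\<^bsub>ab\<^esub>}"
    by (rule ab.derived_eq_singleton) (auto intro!: ab.finprod_closed)
  finally show ?thesis using assms by blast
qed

text \<open>The classes of the sections of [h,_n g] form a family as in
  \<open>torsion_free_shift_differences\<close>, with shift \<open>act g\<close>. So those of
  [h,_1 g] vanish and those of h are constant on orbits of \<open>act g\<close>; as p is prime,
  there is only one orbit.\<close>

lemma left_engel_sections_congruent:
  assumes tf: "torsion_free ab"
    and L: "g \<in> left_engel grp" and act_g: "\<not> (\<forall>i\<in>{1..p}. act g i = i)"
    and h: "h \<in> level_stab p G 1"
    and ij: "i \<in> {1..p}" "j \<in> {1..p}"
  shows "cls (sec h i) = cls (sec h j)"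
proof -
  interpret ab: comm_group ab by (rule comm_group_ab)
  have g: "g \<in> G" and hG: "h \<in> G"
    using L h by (auto simp: left_engel_def mem_level_stab[simplified])
  obtain k where k: "\<And>i. i \<in> {1..p} \<Longrightarrow> act g i = (cyc ^^ k) i"
    using act_cycle_power g by blast
  have power: "(act g ^^ m) i = (i - 1 + k * m) mod p + 1" if i: "i \<in> {1..p}" for m i
  proof (induction m)
    case (Suc m)
    have "(act g ^^ m) i \<in> {1..p}"
      using Suc i by (auto simp: Suc_le_eq)
    then have "(act g ^^ Suc m) i = ((act g ^^ m) i - 1 + k) mod p + 1"
      using k cycle_upt_funpow by simp
    also have "\<dots> = (i - 1 + k * m + k) mod p + 1"
      using Suc by (simp add: mod_add_left_eq del: One_nat_def)
    finally show ?case by (simp add: add_ac)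
  qed (use i in auto)
  let ?c = "\<lambda>n i. cls (sec (iter_comm grp h n g) i)"
  have c_stab: "iter_comm grp h n g \<in> level_stab p G 1" for n
    using h g by (rule iter_comm_in_stab)
  then have cG: "iter_comm grp h n g \<in> G" for n
    unfolding mem_level_stab by blast
  \<comment> \<open>Take sections at i in g x z = x g, where x and z are consecutive iterated
    commutators. Since x fixes the first level, only g shifts the index; the class of
    \<open>sec g i\<close> cancels because \<open>ab\<close> is abelian.\<close>
  have rec: "?c (Suc n) (act g i) \<otimes>\<^bsub>ab\<^esub> ?c n (act g i) = ?c n i" if i: "i \<in> {1..p}" for n i
  proof -
    let ?x = "iter_comm grp h n g" and ?z = "iter_comm grp h (Suc n) g"
    note x = cG[of n] and z = cG[of "Suc n"]
    have gx: "g \<otimes>\<^bsub>grp\<^esub> ?x \<in> G" using g x m_closed by simp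
    have fix_x: "act ?x i = i" "act ?x (act g i) = act g i"
      using c_stab[of n] i g act_range unfolding mem_level_stab by blast+
    have "g \<otimes>\<^bsub>grp\<^esub> ?x \<otimes>\<^bsub>grp\<^esub> ?z = ?x \<otimes>\<^bsub>grp\<^esub> g"
      using comm_elt_unique[of ?x g ?z] g x z by simp
    then have "sec (g \<otimes>\<^bsub>grp\<^esub> ?x \<otimes>\<^bsub>grp\<^esub> ?z) i = sec (?x \<otimes>\<^bsub>grp\<^esub> g) i"
      by (rule arg_cong)
    then have "sec g i \<otimes>\<^bsub>grp\<^esub> sec ?x (act g i) \<otimes>\<^bsub>grp\<^esub> sec ?z (act g i)
        = sec ?x i \<otimes>\<^bsub>grp\<^esub> sec g i"
      by (simp only: sec_mult[OF gx z i] sec_mult[OF g x i] sec_mult[OF x g i]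
          act_mult[OF g x i] fix_x)
    then have "cls (sec g i \<otimes>\<^bsub>grp\<^esub> sec ?x (act g i) \<otimes>\<^bsub>grp\<^esub> sec ?z (act g i))
        = cls (sec ?x i \<otimes>\<^bsub>grp\<^esub> sec g i)"
      by (rule arg_cong)
    moreover have G: "sec g i \<in> G" "sec ?x i \<in> G" "sec ?x (act g i) \<in> G" "sec ?z (act g i) \<in> G"
      using sec_closed[OF g i] sec_closed[OF x i] sec_closed[OF x act_range[OF g i]]
        sec_closed[OF z act_range[OF g i]] .
    moreover have "sec g i \<otimes>\<^bsub>grp\<^esub> sec ?x (act g i) \<in> G"
      using m_closed G by simp
    ultimately have "cls (sec g i) \<otimes>\<^bsub>ab\<^esub> cls (sec ?x (act g i)) \<otimes>\<^bsub>ab\<^esub> cls (sec ?z (act g i))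
        = cls (sec ?x i) \<otimes>\<^bsub>ab\<^esub> cls (sec g i)"
      by (simp only: cls_mult)
    then have "cls (sec g i) \<otimes>\<^bsub>ab\<^esub> (cls (sec ?z (act g i)) \<otimes>\<^bsub>ab\<^esub> cls (sec ?x (act g i)))
        = cls (sec g i) \<otimes>\<^bsub>ab\<^esub> cls (sec ?x i)"
      using G[THEN cls_closed] by (metis ab.m_assoc ab.m_comm)
    then show ?thesis
      using G[THEN cls_closed] by (metis ab.Units_eq ab.Units_l_cancel ab.m_closed)
  qed
  obtain n where n: "1 \<le> n" "iter_comm grp h n g = \<one>\<^bsub>grp\<^esub>"
    using L hG by (auto simp: left_engel_def)
  \<comment> \<open>The Engel exponent is at least 1, hence of the form required by
    \<open>fin\<close> in the shift lemma.\<close>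
  obtain N where "n = Suc N"
    using n(1) by (cases n) auto
  with n(2) have N: "iter_comm grp h (Suc N) g = \<one>\<^bsub>grp\<^esub>" by (simp only:)
  have one: "?c (Suc N) i = \<one>\<^bsub>ab\<^esub>" for i
    by (simp only: N sec_one group_hom.hom_one[OF cls_hom])
  have p0: "0 < p" using prime_p prime_gt_0_nat by blast
  have period: "(act g ^^ p) i = i" if "i \<in> {1..p}" for i
  proof -
    have "(i - 1 + k * p) mod p = i - 1"
      using that by (subst mod_mult_self1) auto
    then show ?thesis using power[OF that, of p] that by (simp del: One_nat_def)
  qed
  have "?c (Suc 0) i = \<one>\<^bsub>ab\<^esub>" if "i \<in> {1..p}" for i
    by (rule ab.torsion_free_shift_differences[OF tf, where I = "{1..p}" and \<tau> = "act g" and m = p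
          and c = ?c and N = N])
      (use act_range[OF g] period p0 rec one cG sec_closed cls_closed that in blast)+
  \<comment> \<open>This is the recursion at n = 0, with its level 1 factor now trivial.\<close>
  then have shift: "cls (sec h (act g i)) = cls (sec h i)" if "i \<in> {1..p}" for i
    using rec[OF that, of 0] act_range[OF g that] that hG by simp
  have iter: "cls (sec h ((act g ^^ m) i)) = cls (sec h i)" for m
  proof (induction m)
    case (Suc m)
    have "(act g ^^ m) i \<in> {1..p}"
      using power[OF ij(1)] p0 by (simp add: Suc_le_eq)
    then show ?case using Suc shift by simp
  qed simp
  have "\<not> p dvd k"
  proof
    assume "p dvd k"
    then have "act g i = i" if "i \<in> {1..p}" for i
      using power[OF that, of 1] that by (auto simp: mod_add_right_eq[symmetric] simp del: mod_add_right_eq)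
    then show False using act_g by blast
  qed
  then have "coprime k p"
    using prime_p by (metis coprime_commute prime_imp_coprime)
  \<comment> \<open>Transitivity: v inverts k modulo p, and u = v (j - i) steps lead from i to j.
    The difference is written j - 1 + (p - (i - 1)) to avoid truncated subtraction.\<close>
  then obtain v where "[k * v = 1] (mod p)"
    using cong_solve_coprime_nat by auto
  then have "[k * (v * (j - 1 + (p - (i - 1)))) = j - 1 + (p - (i - 1))] (mod p)"
    using cong_scalar_right[of "k * v" 1 p "j - 1 + (p - (i - 1))"] by (simp add: mult.assoc)
  then obtain u where u: "(k * u) mod p = (j - 1 + (p - (i - 1))) mod p"
    unfolding cong_def by blast
  have "(act g ^^ u) i = (i - 1 + (j - 1 + (p - (i - 1)))) mod p + 1"
    using power[OF ij(1)] u by (metis mod_add_right_eq)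
  also have "i - 1 + (j - 1 + (p - (i - 1))) = (j - 1) + p"
    using ij by auto
  also have "((j - 1) + p) mod p + 1 = j"
    using ij by (subst mod_add_self2) auto
  finally show ?thesis using iter[of u] by simp
qed

section \<open>Triviality of the set of left Engel elements\<close>

lemma left_engel_trivial:
  assumes tf: "torsion_free ab" and nonab: "\<not> comm_group grp"
  shows "left_engel grp = {\<one>\<^bsub>tree_aut p\<^esub>}"
proof (cases "\<forall>g\<in>left_engel grp. \<forall>i\<in>{1..p}. act g i = i")
  \<comment> \<open>Here all left Engel elements lie in the stabilizer, so their set is closed under
    sections.\<close>
  case True
  have L: "left_engel grp \<subseteq> G" by (auto simp: left_engel_def)
  have "g = \<one>\<^bsub>tree_aut p\<^esub>" if "g \<in> left_engel grp" for g
  proof (rule sections_trivial_imp_trivial[OF _ _ _ that])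
    show "left_engel grp \<subseteq> carrier (tree_aut p)" using L in_tree_aut by blast
    show "act h i = i" if "h \<in> left_engel grp" "i \<in> {1..p}" for h i
      using True that by blast
    then show "sec h i \<in> left_engel grp" if "h \<in> left_engel grp" "i \<in> {1..p}" for h i
      using that L left_engel_section unfolding mem_level_stab by blast
  qed
  moreover have "\<one>\<^bsub>tree_aut p\<^esub> \<in> left_engel grp"
    using one_in_left_engel by simp
  ultimately show ?thesis by blast
next
  case False
  then obtain g where g: "g \<in> left_engel grp" "\<not> (\<forall>i\<in>{1..p}. act g i = i)" by blast
  interpret ab: comm_group ab by (rule comm_group_ab)
  have D: "derived grp G \<subseteq> G" using derived_in_carrier[of G] by simp
  \<comment> \<open>This case is contradictory: the derived subgroup is closed under sections, hence
    trivial, against \<open>nonab\<close>.\<close>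
  have "x = \<one>\<^bsub>tree_aut p\<^esub>" if "x \<in> derived grp G" for x
  proof (rule sections_trivial_imp_trivial[OF _ _ _ that])
    show "derived grp G \<subseteq> carrier (tree_aut p)" using D in_tree_aut by blast
    show "act x i = i" if "x \<in> derived grp G" "i \<in> {1..p}" for x i
      using derived_in_stab that unfolding mem_level_stab by blast
    show "sec x i \<in> derived grp G" if x: "x \<in> derived grp G" and i: "i \<in> {1..p}" for x i
    proof -
      have s: "sec x i \<in> G" using x D i by auto
      \<comment> \<open>All p factors agree, so the product, trivial by
        \<open>prod_cls_sec_derived\<close>, is a p-th power and torsion-freeness applies.\<close>
      have "(\<Otimes>\<^bsub>ab\<^esub>j\<in>{1..p}. cls (sec x j)) = (\<Otimes>\<^bsub>ab\<^esub>j\<in>{1..p}. cls (sec x i))"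
      proof (rule ab.finprod_cong')
        show "cls (sec x j) = cls (sec x i)" if "j \<in> {1..p}" for j
          by (rule left_engel_sections_congruent[OF tf g derived_in_stab[OF x] that i])
      qed (use s in auto)
      also have "\<dots> = cls (sec x i) [^]\<^bsub>ab\<^esub> p"
        using s by (simp add: ab.finprod_const)
      finally have "cls (sec x i) [^]\<^bsub>ab\<^esub> p = \<one>\<^bsub>ab\<^esub>"
        using prod_cls_sec_derived[OF x] by simp
      then have "cls (sec x i) = \<one>\<^bsub>ab\<^esub>"
        using tf cls_closed[OF s] prime_gt_0_nat[OF prime_p] unfolding torsion_free_def by blast
      then show ?thesis using s cls_eq_one by blast
    qed
  qed
  then have "comm_group grp"
    by (intro comm_group_if_derived_trivial) auto
  then show ?thesis using nonab by blast
qed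

end

theorem theorem2:
  fixes p :: nat and G :: "(nat list \<Rightarrow> nat list) set"
  assumes "Factorial_Ring.prime p"
    and "subgroup G (tree_aut p)"
    and "G \<subseteq> Gamma_sylow p"
    and "\<not> comm_group ((tree_aut p)\<lparr>carrier := G\<rparr>)"
    and "fractal p G"
    and "torsion_free (abelianization ((tree_aut p)\<lparr>carrier := G\<rparr>))"
  shows "left_engel ((tree_aut p)\<lparr>carrier := G\<rparr>) = {\<one>\<^bsub>tree_aut p\<^esub>}"
proof -
  interpret fractal_subgroup p G
    using assms by (intro fractal_subgroup.intro)
  show ?thesis using assms(6,4) by (rule left_engel_trivial)
qed

end
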